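(* Let $G$ be an Abelian group and $S$ a subsemigroup of $G$ with $0\in S$. The following conditions are equivalent: (1) the space $G_{\vec S}$ is countably pracompact; (2) the space $G_{\vec S}$ is sequentially pracompact; (3) the subgroup $S-S$ has finite index in $G$ and $S\subseteq C-S$ for some countable set $C\subseteq S$.
   Context: For an Abelian group $G$ (written additively) and a subsemigroup $S\ni 0$ of $G$, $G_{\vec S}$ denotes the group $G$ endowed with the topology consisting of all sets $U\subseteq G$ such that for every $u\in U$ there exists $x\in S$ with $u+x+S\subseteq U$. For $A,B\subseteq G$, $A-B=\{a-b:a\in A,\ b\in B\}$. A space $X$ is countably pracompact if there is a dense set $D\subseteq X$ such that each infinite $B\subseteq D$ has an accumulation point $x\in X$ (each neighborhood of $x$ contains infinitely many points of $B$); sequentially pracompact if there is a dense set $D\subseteq X$ such that each sequence of points of $D$ has a subsequence convergent in $X$. No separation axioms are assumed. *)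

theory Defs
  imports "HOL-Analysis.Analysis"
begin

definition subsemigroup0 :: "'a::ab_group_add set \<Rightarrow> bool" where
  "subsemigroup0 S \<longleftrightarrow> 0 \<in> S \<and> (\<forall>x\<in>S. \<forall>y\<in>S. x + y \<in> S)"

text \<open>The set \<open>A - B = {a - b | a \<in> A, b \<in> B}\<close>; on sets, \<open>-\<close> is already the
  set-theoretic difference.\<close>

definition diff_set :: "'a::ab_group_add set \<Rightarrow> 'a set \<Rightarrow> 'a set" where
  "diff_set A B = {a - b | a b. a \<in> A \<and> b \<in> B}"

definition finite_index :: "'a::ab_group_add set \<Rightarrow> bool" where
  "finite_index H \<longleftrightarrow> finite (range (\<lambda>g. (\<lambda>h. g + h) ` H))"

definition cone_open :: "'a::ab_group_add set \<Rightarrow> 'a set \<Rightarrow> bool" where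
  "cone_open S U \<longleftrightarrow> (\<forall>u\<in>U. \<exists>x\<in>S. (\<lambda>s. u + x + s) ` S \<subseteq> U)"

text \<open>The space \<open>G\<close> endowed with the topology of all \<open>cone_open\<close> sets. The constructor
  \<open>topology\<close> is meaningful only on families satisfying \<open>istopology\<close>; this holds when \<open>S\<close> is a
  subsemigroup containing \<open>0\<close>, see \<open>openin_cone_topology\<close>.\<close>

definition cone_topology :: "'a::ab_group_add set \<Rightarrow> 'a topology" where
  "cone_topology S = topology (cone_open S)"

lemma istopology_cone_open:
  assumes "subsemigroup0 S"
  shows "istopology (cone_open S)"
  unfolding istopology_def
proof (intro conjI allI impI)
  fix U V assume U: "cone_open S U" and V: "cone_open S V"
  show "cone_open S (U \<inter> V)"
    unfolding cone_open_def
  proof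
    fix u assume u: "u \<in> U \<inter> V"
    obtain x where x: "x \<in> S" "\<And>s. s \<in> S \<Longrightarrow> u + x + s \<in> U"
      using U u unfolding cone_open_def by blast
    obtain y where y: "y \<in> S" "\<And>s. s \<in> S \<Longrightarrow> u + y + s \<in> V"
      using V u unfolding cone_open_def by blast
    have add: "a + b \<in> S" if "a \<in> S" "b \<in> S" for a b
      using assms that unfolding subsemigroup0_def by blast
    have "u + (x + y) + s \<in> U \<inter> V" if "s \<in> S" for s
      using x(2)[OF add[OF y(1) that]] y(2)[OF add[OF x(1) that]] by (simp add: ac_simps)
    with add[OF x(1) y(1)] show "\<exists>z\<in>S. (\<lambda>s. u + z + s) ` S \<subseteq> U \<inter> V"
      by blast
  qed
next
  fix K assume "\<forall>U\<in>K. cone_open S U"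
  then show "cone_open S (\<Union>K)"
    unfolding cone_open_def by (meson Union_iff Union_upper order_trans)
qed

lemma openin_cone_topology:
  assumes "subsemigroup0 S"
  shows "openin (cone_topology S) U \<longleftrightarrow> (\<forall>u\<in>U. \<exists>x\<in>S. (\<lambda>s. u + x + s) ` S \<subseteq> U)"
  using topology_inverse'[OF istopology_cone_open[OF assms]]
  by (simp add: cone_topology_def cone_open_def)

lemma topspace_cone_topology:
  assumes "subsemigroup0 S"
  shows "topspace (cone_topology S) = UNIV"
proof -
  have "openin (cone_topology S) UNIV"
    using assms by (auto simp: openin_cone_topology subsemigroup0_def)
  then show ?thesis
    using openin_subset by blast
qed

definition dense_in_space :: "'a topology \<Rightarrow> 'a set \<Rightarrow> bool" where
  "dense_in_space X D \<longleftrightarrow> D \<subseteq> topspace X \<and> X closure_of D = topspace X"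

text \<open>Without the T1 axiom this is stronger than \<open>x \<in> X derived_set_of B\<close>, which only asks that
  each neighborhood of \<open>x\<close> contain one point of \<open>B\<close> other than \<open>x\<close>.\<close>

definition accumulation_point :: "'a topology \<Rightarrow> 'a set \<Rightarrow> 'a \<Rightarrow> bool" where
  "accumulation_point X B x \<longleftrightarrow>
     x \<in> topspace X \<and> (\<forall>U. openin X U \<and> x \<in> U \<longrightarrow> infinite (U \<inter> B))"

definition countably_pracompact :: "'a topology \<Rightarrow> bool" where
  "countably_pracompact X \<longleftrightarrow>
     (\<exists>D. dense_in_space X D \<and>
          (\<forall>B. B \<subseteq> D \<and> infinite B \<longrightarrow> (\<exists>x. accumulation_point X B x)))"

definition sequentially_pracompact :: "'a topology \<Rightarrow> bool" where
  "sequentially_pracompact X \<longleftrightarrow>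
     (\<exists>D. dense_in_space X D \<and>
          (\<forall>f :: nat \<Rightarrow> 'a. range f \<subseteq> D \<longrightarrow>
             (\<exists>r x. strict_mono r \<and> limitin X (f \<circ> r) x sequentially)))"

end

theory Submission
  imports Defs
begin

text \<open>
  Preorder \<open>G\<close> by \<open>g \<le> h \<longleftrightarrow> h - g \<in> S\<close>. A set is dense in the cone topology iff it is cofinal
  for this preorder, and a set \<open>B\<close> accumulates at \<open>x\<close> iff it has infinitely many elements above
  every element of \<open>x + S\<close>. If \<open>C \<subseteq> S\<close> is countable and cofinal in \<open>S\<close>, the partial sums \<open>c n\<close> of
  an enumeration of \<open>C\<close> are eventually above each element of \<open>S\<close>; hence for a finite set \<open>F\<close> of coset
  representatives of \<open>S - S\<close> the set of all \<open>f + c n\<close> with \<open>f \<in> F\<close> is dense and each of its sequences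
  has a convergent subsequence. Conversely, let \<open>D\<close> be a dense set whose infinite subsets accumulate.
  It meets every coset of \<open>S - S\<close>, and a choice of one point from each coset has no accumulation
  point if there are infinitely many cosets. Moreover \<open>D \<inter> S\<close> is cofinal in \<open>S\<close>, and so is each of
  its infinite, in particular its countably infinite, subsets.
\<close>

section \<open>Neighbourhoods, density and limits in the cone topology\<close>

text \<open>The cone \<open>g + x + S\<close> contains the cone of each of its points but may miss
  \<open>g\<close>. With \<open>g\<close> added, these sets form a neighbourhood base at
  \<open>g\<close>.\<close>

lemma openin_cone_insert:
  assumes S: "subsemigroup0 S" and x: "x \<in> S"
  shows "openin (cone_topology S) (insert g ((\<lambda>s. g + x + s) ` S))"
proof -
  have "\<exists>y\<in>S. (\<lambda>s. u + y + s) ` S \<subseteq> insert g ((\<lambda>s. g + x + s) ` S)"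
    if u: "u \<in> insert g ((\<lambda>s. g + x + s) ` S)" for u
  proof (cases "u = g")
    case True
    then show ?thesis using x by blast
  next
    case False
    then obtain t where t: "t \<in> S" "u = g + x + t"
      using u by blast
    have "u + 0 + s \<in> (\<lambda>s. g + x + s) ` S" if "s \<in> S" for s
      using S t that by (auto simp: subsemigroup0_def add.assoc intro!: image_eqI[of _ _ "t + s"])
    moreover have "0 \<in> S"
      using S by (simp add: subsemigroup0_def)
    ultimately show ?thesis by blast
  qed
  then show ?thesis
    using openin_cone_topology[OF S] by blast
qed

lemma openin_cone:
  assumes "subsemigroup0 S"
  shows "openin (cone_topology S) ((\<lambda>s. g + s) ` S)"
proof -
  have "0 \<in> S"
    using assms by (simp add: subsemigroup0_def)
  then have "insert g ((\<lambda>s. g + 0 + s) ` S) = (\<lambda>s. g + s) ` S"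
    by (auto intro: image_eqI[of _ _ 0])
  then show ?thesis
    using openin_cone_insert[OF assms \<open>0 \<in> S\<close>, of g] by simp
qed

lemma dense_in_cone_topology_iff:
  assumes S: "subsemigroup0 S"
  shows "dense_in_space (cone_topology S) D \<longleftrightarrow> (\<forall>g. \<exists>s\<in>S. g + s \<in> D)"
proof
  assume D: "dense_in_space (cone_topology S) D"
  show "\<forall>g. \<exists>s\<in>S. g + s \<in> D"
  proof
    fix g
    have "0 \<in> S"
      using S by (simp add: subsemigroup0_def)
    then have "g \<in> (\<lambda>s. g + s) ` S"
      by (auto intro: image_eqI[of _ _ 0])
    moreover have "g \<in> cone_topology S closure_of D"
      using D by (simp add: dense_in_space_def topspace_cone_topology[OF S])
    ultimately show "\<exists>s\<in>S. g + s \<in> D"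
      using openin_cone[OF S, of g] unfolding in_closure_of by blast
  qed
next
  assume D: "\<forall>g. \<exists>s\<in>S. g + s \<in> D"
  have "g \<in> cone_topology S closure_of D" for g
    unfolding in_closure_of
  proof (intro conjI allI impI)
    show "g \<in> topspace (cone_topology S)"
      by (simp add: topspace_cone_topology[OF S])
    fix U assume "g \<in> U \<and> openin (cone_topology S) U"
    then obtain x where x: "(\<lambda>s. g + x + s) ` S \<subseteq> U"
      using openin_cone_topology[OF S] by blast
    \<comment> \<open>Cofinality is applied at \<open>g + x\<close>, not at \<open>g\<close>, so
      that the point found lies in the cone contained in \<open>U\<close>.\<close>
    obtain s where "s \<in> S" "g + x + s \<in> D"
      using D by blast
    then show "\<exists>y. y \<in> D \<and> y \<in> U"
      using x by blast
  qed
  then show "dense_in_space (cone_topology S) D"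
    by (auto simp: dense_in_space_def topspace_cone_topology[OF S])
qed

text \<open>Each neighbourhood of \<open>g\<close> contains some cone \<open>g + x + S\<close>. The
  criterion is only sufficient: the constant sequence \<open>g\<close> converges to \<open>g\<close>
  without having to enter these cones.\<close>

lemma limitin_cone_topology:
  assumes S: "subsemigroup0 S"
    and ev: "\<And>x. x \<in> S \<Longrightarrow> eventually (\<lambda>n. f n - (g + x) \<in> S) F"
  shows "limitin (cone_topology S) f g F"
  unfolding limitin_def
proof (intro conjI allI impI)
  show "g \<in> topspace (cone_topology S)"
    by (simp add: topspace_cone_topology[OF S])
  fix U assume "openin (cone_topology S) U \<and> g \<in> U"
  then obtain x where x: "x \<in> S" and U: "(\<lambda>s. g + x + s) ` S \<subseteq> U"
    using openin_cone_topology[OF S] by blast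
  show "eventually (\<lambda>n. f n \<in> U) F"
    using ev[OF x]
  proof eventually_elim
    case (elim n)
    then have "g + x + (f n - (g + x)) \<in> U"
      using U by blast
    then show ?case by simp
  qed
qed

text \<open>The cone differs from a neighbourhood of \<open>g\<close> by at most the point
  \<open>g\<close>, which does not affect infinitude.\<close>

lemma accumulation_point_cone_topologyD:
  assumes S: "subsemigroup0 S" and x: "x \<in> S"
    and acc: "accumulation_point (cone_topology S) B g"
  shows "infinite ((\<lambda>s. g + x + s) ` S \<inter> B)"
proof
  assume "finite ((\<lambda>s. g + x + s) ` S \<inter> B)"
  then have "finite (insert g ((\<lambda>s. g + x + s) ` S) \<inter> B)"
    by (simp add: Int_insert_left)
  then show False
    using acc openin_cone_insert[OF S x, of g] by (auto simp: accumulation_point_def)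
qed

section \<open>The two pracompactness properties in arbitrary spaces\<close>

lemma sequentially_imp_countably_pracompact:
  assumes "sequentially_pracompact X"
  shows "countably_pracompact X"
proof -
  obtain D where D: "dense_in_space X D"
    and seq: "\<And>f :: nat \<Rightarrow> 'a. range f \<subseteq> D \<Longrightarrow>
             \<exists>r x. strict_mono r \<and> limitin X (f \<circ> r) x sequentially"
    using assms unfolding sequentially_pracompact_def by blast
  have "\<exists>x. accumulation_point X B x" if B: "B \<subseteq> D" "infinite B" for B
  proof -
    obtain f :: "nat \<Rightarrow> 'a" where f: "inj f" "range f \<subseteq> B"
      using infinite_countable_subset[OF B(2)] by blast
    then obtain r x where r: "strict_mono r" and lim: "limitin X (f \<circ> r) x sequentially"
      using seq[of f] B(1) by blast
    have "infinite (U \<inter> B)" if U: "openin X U" "x \<in> U" for U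
    proof -
      obtain N where N: "\<And>n. n \<ge> N \<Longrightarrow> f (r n) \<in> U"
        using lim U unfolding limitin_def eventually_sequentially by auto
      \<comment> \<open>Injectivity turns the infinitely many indices of a tail into infinitely many
        points of \<open>B\<close>.\<close>
      have "inj (f \<circ> r)"
        using f(1) r by (simp add: inj_compose strict_mono_imp_inj_on)
      then have "infinite ((f \<circ> r) ` {N..})"
        using finite_imageD[of "f \<circ> r" "{N..}"] infinite_Ici inj_on_subset by blast
      moreover have "(f \<circ> r) ` {N..} \<subseteq> U \<inter> B"
        using N f(2) by auto
      ultimately show ?thesis
        using finite_subset by blast
    qed
    moreover have "x \<in> topspace X"
      using lim by (simp add: limitin_def)
    ultimately show ?thesis
      unfolding accumulation_point_def by blast
  qed
  then show ?thesis
    using D unfolding countably_pracompact_def by blast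
qed

section \<open>The subgroup \<open>S - S\<close> and its cosets\<close>

lemma diff_set_add:
  assumes S: "subsemigroup0 S" and "a \<in> diff_set S S" "b \<in> diff_set S S"
  shows "a + b \<in> diff_set S S"
proof -
  obtain p q p' q' where "p \<in> S" "q \<in> S" "p' \<in> S" "q' \<in> S" "a = p - q" "b = p' - q'"
    using assms(2,3) unfolding diff_set_def by blast
  moreover have "p - q + (p' - q') = (p + p') - (q + q')"
    by (simp add: algebra_simps)
  ultimately show ?thesis
    using S unfolding diff_set_def subsemigroup0_def by blast
qed

lemma diff_set_uminus: "a \<in> diff_set S S \<Longrightarrow> - a \<in> diff_set S S"
  unfolding diff_set_def by force

lemma diff_set_superset:
  assumes "subsemigroup0 S" "s \<in> S"
  shows "s \<in> diff_set S S"
proof -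
  have "0 \<in> S" "s = s - 0"
    using assms(1) by (auto simp: subsemigroup0_def)
  then show ?thesis
    using assms(2) unfolding diff_set_def by blast
qed

lemma coset_diff_set_eq_iff:
  assumes S: "subsemigroup0 S"
  shows "(\<lambda>h. a + h) ` diff_set S S = (\<lambda>h. b + h) ` diff_set S S \<longleftrightarrow> a - b \<in> diff_set S S"
proof
  assume eq: "(\<lambda>h. a + h) ` diff_set S S = (\<lambda>h. b + h) ` diff_set S S"
  have "0 \<in> diff_set S S"
    using S diff_set_superset[OF S, of 0] by (simp add: subsemigroup0_def)
  then have "a \<in> (\<lambda>h. a + h) ` diff_set S S"
    by (auto intro: image_eqI[of _ _ 0])
  then show "a - b \<in> diff_set S S"
    unfolding eq by auto
next
  \<comment> \<open>Stated for arbitrary \<open>a\<close> and \<open>b\<close>, so that exchanging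
    them gives the reverse inclusion.\<close>
  have sub: "(\<lambda>h. a + h) ` diff_set S S \<subseteq> (\<lambda>h. b + h) ` diff_set S S"
    if "a - b \<in> diff_set S S" for a b
  proof
    fix y assume "y \<in> (\<lambda>h. a + h) ` diff_set S S"
    then obtain h where h: "h \<in> diff_set S S" "y = b + ((a - b) + h)"
      by (auto simp: algebra_simps)
    then show "y \<in> (\<lambda>h. b + h) ` diff_set S S"
      using diff_set_add[OF S that h(1)] by blast
  qed
  assume ab: "a - b \<in> diff_set S S"
  then have "b - a \<in> diff_set S S"
    using diff_set_uminus by fastforce
  with ab show "(\<lambda>h. a + h) ` diff_set S S = (\<lambda>h. b + h) ` diff_set S S"
    using sub by blast
qed

section \<open>Necessity of finite index and of a countable cofinal set\<close>

text \<open>The cone \<open>x + S\<close> lies in a single coset of \<open>S - S\<close>, so a set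
  with at most one point in each coset meets it at most once and cannot accumulate at
  \<open>x\<close>.\<close>

lemma countably_pracompact_imp_finite_index:
  assumes S: "subsemigroup0 S" and cp: "countably_pracompact (cone_topology S)"
  shows "finite_index (diff_set S S)"
proof (rule ccontr)
  let ?H = "diff_set S S"
  let ?coset = "\<lambda>g. (\<lambda>h. g + h) ` ?H"
  assume "\<not> finite_index ?H"
  then have inf: "infinite (range ?coset)"
    by (simp add: finite_index_def)
  obtain D where D: "\<And>g. \<exists>s\<in>S. g + s \<in> D"
    and acc: "\<And>B. B \<subseteq> D \<Longrightarrow> infinite B \<Longrightarrow> \<exists>x. accumulation_point (cone_topology S) B x"
    using cp dense_in_cone_topology_iff[OF S] unfolding countably_pracompact_def by blast
  have "range ?coset \<subseteq> ?coset ` D"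
  proof
    fix A assume "A \<in> range ?coset"
    then obtain g where A: "A = ?coset g" by blast
    obtain s where s: "s \<in> S" "g + s \<in> D"
      using D by blast
    have "A = ?coset (g + s)"
      unfolding A using coset_diff_set_eq_iff[OF S, of "g + s" g] diff_set_superset[OF S s(1)]
      by simp
    then show "A \<in> ?coset ` D"
      using s(2) by blast
  qed
  \<comment> \<open>\<open>B\<close> picks from \<open>D\<close> exactly one point of every
    coset.\<close>
  then obtain B where B: "B \<subseteq> D" "inj_on ?coset B" "range ?coset = ?coset ` B"
    using subset_image_inj[of "range ?coset" ?coset D] by auto
  then have "infinite B"
    using inf by auto
  then obtain x where x: "accumulation_point (cone_topology S) B x"
    using acc B(1) by blast
  have "0 \<in> S"
    using S by (simp add: subsemigroup0_def)
  then have "infinite ((\<lambda>s. x + 0 + s) ` S \<inter> B)"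
    by (rule accumulation_point_cone_topologyD[OF S _ x])
  moreover have "b = b'"
    if b: "b \<in> (\<lambda>s. x + 0 + s) ` S \<inter> B" "b' \<in> (\<lambda>s. x + 0 + s) ` S \<inter> B" for b b'
  proof -
    have "b - b' \<in> ?H"
      using b unfolding diff_set_def by force
    then show ?thesis
      using b coset_diff_set_eq_iff[OF S] inj_onD[OF B(2), of b b'] by blast
  qed
  ultimately show False
    by (metis finite.emptyI finite_insert finite_subset insertI1 subsetI)
qed

lemma countably_pracompact_imp_countable_cofinal:
  assumes S: "subsemigroup0 S" and cp: "countably_pracompact (cone_topology S)"
  shows "\<exists>C. countable C \<and> C \<subseteq> S \<and> S \<subseteq> diff_set C S"
proof -
  have add: "a + b \<in> S" if "a \<in> S" "b \<in> S" for a b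
    using S that unfolding subsemigroup0_def by blast
  have zero: "0 \<in> S"
    using S unfolding subsemigroup0_def by blast
  obtain D where D: "\<And>g. \<exists>s\<in>S. g + s \<in> D"
    and acc: "\<And>B. B \<subseteq> D \<Longrightarrow> infinite B \<Longrightarrow> \<exists>x. accumulation_point (cone_topology S) B x"
    using cp dense_in_cone_topology_iff[OF S] unfolding countably_pracompact_def by blast
  show ?thesis
  proof (cases "finite (D \<inter> S)")
    \<comment> \<open>No infinite subset is available here, but \<open>D \<inter> S\<close> is
      itself countable and cofinal in \<open>S\<close>.\<close>
    case True
    have "s \<in> diff_set (D \<inter> S) S" if s: "s \<in> S" for s
    proof -
      obtain t where t: "t \<in> S" "s + t \<in> D"
        using D by blast
      then have "s + t \<in> D \<inter> S" "s = (s + t) - t"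
        using add s by auto
      then show ?thesis
        using t unfolding diff_set_def by blast
    qed
    then show ?thesis
      using True by (intro exI[of _ "D \<inter> S"]) (auto simp: countable_finite)
  next
    case False
    then obtain B where B: "B \<subseteq> D \<inter> S" "countable B" "infinite B"
      using infinite_countable_subset'[of "D \<inter> S"] by metis
    then obtain x where x: "accumulation_point (cone_topology S) B x"
      using acc by blast
    have meets: "\<exists>t\<in>S. x + y + t \<in> B" if "y \<in> S" for y
    proof -
      have "(\<lambda>s. x + y + s) ` S \<inter> B \<noteq> {}"
        using accumulation_point_cone_topologyD[OF S that x] by force
      then show ?thesis by blast
    qed
    \<comment> \<open>The accumulation point \<open>x\<close> may lie outside \<open>S\<close>.
      Passing to \<open>x + t\<close>, a point of \<open>B \<subseteq> S\<close>, makes every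
      element of \<open>B\<close> above \<open>x + t + s\<close> also lie above
      \<open>s\<close>.\<close>
    obtain t where t: "t \<in> S" "x + t \<in> B"
      using meets[OF zero] by auto
    have "s \<in> diff_set B S" if s: "s \<in> S" for s
    proof -
      obtain r where r: "r \<in> S" "x + (t + s) + r \<in> B"
        using meets[OF add[OF t(1) s]] by blast
      have "x + t + r \<in> S"
        using add r(1) t(2) B(1) by blast
      moreover have "s = (x + (t + s) + r) - (x + t + r)"
        by (simp add: algebra_simps)
      ultimately show ?thesis
        using r(2) unfolding diff_set_def by blast
    qed
    then show ?thesis
      using B by blast
  qed
qed

section \<open>Sufficiency: a dense set with convergent subsequences\<close>

text \<open>A partial sum lies above each of its summands, because the remaining ones add up to an
  element of \<open>S\<close>. Bounds for all of \<open>S - S\<close> are needed to compare points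
  of the same coset.\<close>

lemma countable_cofinal_imp_sequence:
  assumes S: "subsemigroup0 S" and C: "countable C" "C \<subseteq> S" "S \<subseteq> diff_set C S"
  shows "\<exists>c :: nat \<Rightarrow> 'a::ab_group_add. \<forall>h\<in>diff_set S S. \<exists>N. \<forall>n\<ge>N. c n - h \<in> S"
proof -
  have add: "a + b \<in> S" if "a \<in> S" "b \<in> S" for a b
    using S that unfolding subsemigroup0_def by blast
  have zero: "0 \<in> S"
    using S unfolding subsemigroup0_def by blast
  have "C \<noteq> {}"
    using C(3) zero unfolding diff_set_def by blast
  then obtain e :: "nat \<Rightarrow> 'a" where e: "range e = C"
    using range_from_nat_into[OF _ C(1)] by blast
  then have "e n \<in> S" for n
    using C(2) by blast
  \<comment> \<open>For infinite \<open>A\<close> the sum is 0 by convention, again an element of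
    \<open>S\<close>.\<close>
  then have sum: "sum e A \<in> S" for A
    by (induction A rule: infinite_finite_induct) (simp_all add: zero add)
  have "\<forall>h\<in>diff_set S S. \<exists>N. \<forall>n\<ge>N. sum e {..n} - h \<in> S"
  proof
    fix h assume "h \<in> diff_set S S"
    then obtain p q where pq: "p \<in> S" "q \<in> S" "h = p - q"
      unfolding diff_set_def by blast
    obtain k t where k: "t \<in> S" "p = e k - t"
      using C(3) pq(1) e unfolding diff_set_def by blast
    have "sum e {..n} - h \<in> S" if "n \<ge> k" for n
    proof -
      have "sum e {..n} = e k + sum e ({..n} - {k})"
        using that by (intro sum.remove) auto
      then have "sum e {..n} - h = sum e ({..n} - {k}) + t + q"
        using pq k by (simp add: algebra_simps)
      then show ?thesis
        using add sum k(1) pq(2) by simp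
    qed
    then show "\<exists>N. \<forall>n\<ge>N. sum e {..n} - h \<in> S" by blast
  qed
  then show ?thesis
    by (intro exI[of _ "\<lambda>n. sum e {..n}"])
qed

lemma strict_mono_subseq_in_infinite:
  assumes "infinite (A :: nat set)"
  shows "\<exists>r :: nat \<Rightarrow> nat. strict_mono r \<and> (\<forall>n. r n \<in> A)"
  using strict_mono_enumerate[OF assms] enumerate_in_set[OF assms] by blast

text \<open>If no value is taken infinitely often, only finitely many terms lie below any bound, and
  the whole sequence already tends to infinity.\<close>

lemma nat_seq_constant_or_unbounded_subseq:
  fixes m :: "nat \<Rightarrow> nat"
  obtains (const) r :: "nat \<Rightarrow> nat" and k where "strict_mono r" "\<And>n. m (r n) = k"
    | (unbounded) r :: "nat \<Rightarrow> nat" where "strict_mono r" "filterlim (m \<circ> r) at_top sequentially"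
proof (cases "\<exists>k. infinite {n. m n = k}")
  case True
  then obtain k where k: "infinite {n. m n = k}" by blast
  obtain r :: "nat \<Rightarrow> nat" where "strict_mono r" "\<forall>n. r n \<in> {n. m n = k}"
    using strict_mono_subseq_in_infinite[OF k] by blast
  then show ?thesis
    by (intro const[of r k]) auto
next
  case False
  have "eventually (\<lambda>n. m n \<ge> Z) sequentially" for Z
  proof -
    have "{n. \<not> m n \<ge> Z} = (\<Union>k<Z. {n. m n = k})"
      by auto
    then have "finite {n. \<not> m n \<ge> Z}"
      using False by simp
    then show ?thesis
      by (simp add: cofinite_eq_sequentially[symmetric] eventually_cofinite)
  qed
  then have "filterlim (m \<circ> id) at_top sequentially"
    by (simp add: filterlim_at_top)
  then show ?thesis
    using strict_mono_id by (intro unbounded)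
qed

lemma finite_range_representatives:
  assumes "finite (range f)"
  obtains F where "finite F" "range f = f ` F"
  using finite_subset_image[OF assms, of f UNIV] by auto

lemma sequentially_pracompactI:
  assumes S: "subsemigroup0 S" and fin: "finite_index (diff_set S S)"
    and C: "countable C" "C \<subseteq> S" "S \<subseteq> diff_set C S"
  shows "sequentially_pracompact (cone_topology S)"
proof -
  define coset where "coset g = (\<lambda>h. g + h) ` diff_set S S" for g
  have coset_eq: "coset a = coset b \<longleftrightarrow> a - b \<in> diff_set S S" for a b
    unfolding coset_def by (rule coset_diff_set_eq_iff[OF S])
  obtain c :: "nat \<Rightarrow> 'a" where c: "\<And>h. h \<in> diff_set S S \<Longrightarrow> \<exists>N. \<forall>n\<ge>N. c n - h \<in> S"
    using countable_cofinal_imp_sequence[OF S C] by metis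
  obtain F where F: "finite F" "range coset = coset ` F"
    using fin unfolding finite_index_def coset_def[symmetric]
    by (rule finite_range_representatives)
  define D where "D = (\<lambda>(f, n). f + c n) ` (F \<times> UNIV)"
  have "\<exists>s\<in>S. g + s \<in> D" for g
  proof -
    obtain f where f: "f \<in> F" "coset g = coset f"
      using F(2) by blast
    \<comment> \<open>\<open>g - f\<close> lies in \<open>S - S\<close>, so \<open>c n\<close> is
      eventually above it; equivalently, \<open>f + c n\<close> is above \<open>g\<close>.\<close>
    then obtain n where n: "c n - (g - f) \<in> S"
      using coset_eq c by blast
    have "g + (c n - (g - f)) = f + c n"
      by (simp add: algebra_simps)
    then have "g + (c n - (g - f)) \<in> D"
      unfolding D_def using f(1) by force
    then show ?thesis
      using n by blast
  qed
  then have "dense_in_space (cone_topology S) D"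
    using dense_in_cone_topology_iff[OF S] by blast
  moreover have "\<exists>r x. strict_mono r \<and> limitin (cone_topology S) (d \<circ> r) x sequentially"
    if d: "range d \<subseteq> D" for d :: "nat \<Rightarrow> 'a"
  proof -
    have "\<exists>p. fst p \<in> F \<and> d n = fst p + c (snd p)" for n
      using d unfolding D_def by force
    then obtain p where p: "\<And>n. fst (p n) \<in> F" "\<And>n. d n = fst (p n) + c (snd (p n))"
      by metis
    have "range (fst \<circ> p) \<subseteq> F"
      using p(1) by auto
    then have "finite (range (fst \<circ> p))"
      using F(1) finite_subset by blast
    \<comment> \<open>As \<open>F\<close> is finite, some representative recurs infinitely often;
      along \<open>q\<close> only the index of \<open>c\<close> still varies.\<close>
    then obtain n0 where n0: "infinite {n. fst (p n) = fst (p n0)}"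
      using pigeonhole_infinite[of "UNIV :: nat set" "fst \<circ> p"] by auto
    obtain q :: "nat \<Rightarrow> nat" where q: "strict_mono q" "\<forall>n. q n \<in> {n. fst (p n) = fst (p n0)}"
      using strict_mono_subseq_in_infinite[OF n0] by blast
    define f where "f = fst (p n0)"
    have dq: "d (q n) = f + c (snd (p (q n)))" for n
      using p(2) q(2) by (simp add: f_def)
    show ?thesis
    proof (cases "\<lambda>n. snd (p (q n))" rule: nat_seq_constant_or_unbounded_subseq)
      case (const r k)
      then have "d \<circ> (q \<circ> r) = (\<lambda>n. f + c k)"
        using dq by auto
      then have "limitin (cone_topology S) (d \<circ> (q \<circ> r)) (f + c k) sequentially"
        by (simp add: limitin_const topspace_cone_topology[OF S])
      then show ?thesis
        using strict_mono_o[OF q(1) const(1)] by blast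
    next
      \<comment> \<open>The limit is the representative \<open>f\<close> itself: after cancelling
        \<open>f\<close>, the terms \<open>c m\<close> with \<open>m\<close> tending to infinity are
        eventually above each \<open>x\<close> in \<open>S\<close>.\<close>
      case (unbounded r)
      have "limitin (cone_topology S) (d \<circ> (q \<circ> r)) f sequentially"
      proof (rule limitin_cone_topology[OF S])
        fix x assume "x \<in> S"
        then have "eventually (\<lambda>n. c n - x \<in> S) sequentially"
          using c diff_set_superset[OF S] unfolding eventually_sequentially by blast
        then have "eventually (\<lambda>n. c (snd (p (q (r n)))) - x \<in> S) sequentially"
          using unbounded(2) by (auto simp: filterlim_iff)
        then show "eventually (\<lambda>n. (d \<circ> (q \<circ> r)) n - (f + x) \<in> S) sequentially"
          by (simp add: dq)
      qed
      then show ?thesis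
        using strict_mono_o[OF q(1) unbounded(1)] by blast
    qed
  qed
  ultimately show ?thesis
    unfolding sequentially_pracompact_def by blast
qed

theorem proposition5p17:
  fixes S :: "'a::ab_group_add set"
  assumes "subsemigroup0 S"
  shows "(countably_pracompact (cone_topology S) \<longleftrightarrow> sequentially_pracompact (cone_topology S)) \<and>
         (sequentially_pracompact (cone_topology S) \<longleftrightarrow>
            finite_index (diff_set S S) \<and>
            (\<exists>C. countable C \<and> C \<subseteq> S \<and> S \<subseteq> diff_set C S))"
  \<comment> \<open>The implications form a cycle: sequential to countable pracompactness, then to
    the two algebraic conditions, then back.\<close>
  using sequentially_imp_countably_pracompact[of "cone_topology S"]
    countably_pracompact_imp_finite_index[OF assms]
    countably_pracompact_imp_countable_cofinal[OF assms]
    sequentially_pracompactI[OF assms]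
  by blast

end
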